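(* Let $n\ge 1$ and $m\ge 2$ be integers and let $A=(a_{i_1\cdots i_m})_{(i_1,\ldots,i_m)\in[n]^m}\in\mathbb{R}^{n^m}$ be a real tensor of order $m$ and rank $n$. Then $A$ has a unique tropical H-eigenvalue $\lambda(A)\in\mathbb{R}$; that is, there exists exactly one $\lambda\in\mathbb{R}$ for which there is some $x\in\mathbb{R}^n$ with \[ \min_{i_2,\ldots,i_m\in[n]}\bigl(a_{i\, i_2\cdots i_m}+x_{i_2}+\cdots+x_{i_m}\bigr)=\lambda+(m-1)x_i\qquad\text{for all } i=1,\ldots,n. \]
   Context: Tropical arithmetic uses $\oplus=\min$ and $\odot=+$. A tropical H-eigenpair of a tensor $A=(a_{i_1\cdots i_m})$ of order $m$ and rank $n$ is a pair $(x,\lambda)\in\mathbb{R}^n/\mathbb{R}(1,\ldots,1)\times\mathbb{R}$ satisfying $\bigoplus_{i_2,\ldots,i_m=1}^n a_{i i_2\cdots i_m}\odot x_{i_2}\odot\cdots\odot x_{i_m}=\lambda\odot x_i^{\odot(m-1)}$ for $i=1,\ldots,n$, i.e. the displayed min-plus equations; $\lambda$ is then called a tropical H-eigenvalue and $x$ a tropical H-eigenvector. *)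

theory Defs
  imports "HOL-Analysis.Analysis"
begin

text \<open>
  Indices range over a finite type \<open>'n\<close>, so \<open>n = CARD('n) \<ge> 1\<close> and vectors are of
  type \<^typ>\<open>real ^ 'n\<close>.  A tensor of order \<open>m\<close> and rank \<open>n\<close> is a function on lists of
  indices, with entry \<open>A [i\<^sub>1, \<dots>, i\<^sub>m]\<close>; only its values on lists of length \<open>m\<close> matter.
  Vectors are representatives of classes in \<open>\<real>\<^sup>n / \<real>(1, \<dots>, 1)\<close>; the lemma below shows
  that the notion of eigenpair is well defined on classes.
\<close>

definition tropical_H_eigenpair ::
    "nat \<Rightarrow> ('n::finite list \<Rightarrow> real) \<Rightarrow> real ^ 'n \<Rightarrow> real \<Rightarrow> bool" where
  "tropical_H_eigenpair m A x lam \<longleftrightarrow>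
     (\<forall>i. Min ((\<lambda>js. A (i # js) + (\<Sum>j\<leftarrow>js. x $ j)) ` {js. length js = m - 1}) =
          lam + real (m - 1) * x $ i)"

definition tropical_H_eigenvalue ::
    "nat \<Rightarrow> ('n::finite list \<Rightarrow> real) \<Rightarrow> real \<Rightarrow> bool" where
  "tropical_H_eigenvalue m A lam \<longleftrightarrow> (\<exists>x. tropical_H_eigenpair m A x lam)"

lemma tropical_H_eigenpair_translate:
  fixes A :: "'n::finite list \<Rightarrow> real" and x :: "real ^ 'n"
  assumes "tropical_H_eigenpair m A x lam"
  shows "tropical_H_eigenpair m A (x + c *\<^sub>R (\<chi> i. 1)) lam"
  unfolding tropical_H_eigenpair_def
proof
  fix i :: 'n
  let ?J = "{js :: 'n list. length js = m - 1}"
  let ?f = "\<lambda>js. A (i # js) + (\<Sum>j\<leftarrow>js. x $ j)"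
  let ?g = "\<lambda>js. A (i # js) + (\<Sum>j\<leftarrow>js. (x + c *\<^sub>R (\<chi> i. 1)) $ j)"
  have fin: "finite ?J"
    using finite_lists_length_eq[of "UNIV :: 'n set" "m - 1"] by simp
  have ne: "?J \<noteq> {}"
    using length_replicate[of "m - 1" i] by blast
  have sum: "(\<Sum>j\<leftarrow>js. (x + c *\<^sub>R (\<chi> i. 1)) $ j) = (\<Sum>j\<leftarrow>js. x $ j) + real (length js) * c" for js
    by (induction js) (auto simp: algebra_simps)
  have "?g ` ?J = (\<lambda>js. ?f js + real (m - 1) * c) ` ?J"
    by (rule image_cong) (simp_all only: sum mem_Collect_eq add.assoc)
  then have "Min (?g ` ?J) = Min (?f ` ?J) + real (m - 1) * c"
    using Min_add_commute[OF fin ne, of ?f "real (m - 1) * c"] by (simp only:)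
  also have "Min (?f ` ?J) = lam + real (m - 1) * x $ i"
    using assms unfolding tropical_H_eigenpair_def by blast
  finally show "Min (?g ` ?J) = lam + real (m - 1) * (x + c *\<^sub>R (\<chi> i. 1)) $ i"
    by (simp add: algebra_simps)
qed

end

theory Submission
  imports Defs
begin

text \<open>
  Let \<open>T x\<close> be the vector of left-hand sides divided by \<open>m - 1\<close>.  The map \<open>T\<close> is monotone and
  commutes with adding constants, and comparing two eigenvectors at an index where their
  difference is maximal yields uniqueness.  For existence, all entries of \<open>T x\<close> differ from
  \<open>min x\<close> by an amount lying between \<open>min A / (m - 1)\<close> and \<open>max A / (m - 1)\<close> (take all indices equal
  to a minimiser of \<open>x\<close>).  Hence \<open>T x - min (T x)\<close> maps a fixed box into itself, and a Brouwer
  fixed point of this map is an eigenvector.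
\<close>

lemma continuous_on_Min_image:
  fixes f :: "'i \<Rightarrow> 'a::topological_space \<Rightarrow> 'b::linorder_topology"
  assumes "finite J" "J \<noteq> {}" "\<And>j. j \<in> J \<Longrightarrow> continuous_on S (f j)"
  shows "continuous_on S (\<lambda>x. Min ((\<lambda>j. f j x) ` J))"
  using assms
proof (induction J rule: finite_ne_induct)
  case (insert j J)
  then have "continuous_on S (\<lambda>x. min (f j x) (Min ((\<lambda>j. f j x) ` J)))"
    by (intro continuous_on_min) auto
  with insert show ?case
    by simp
qed simp

lemma continuous_on_sum_list_nth:
  "continuous_on S (\<lambda>x :: real ^ 'n::finite. \<Sum>j\<leftarrow>js. x $ j)"
  by (induction js) (auto intro!: continuous_intros)

lemma finite_lists_of_length: "finite {js :: 'n::finite list. length js = k}"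
  using finite_lists_length_eq[of "UNIV :: 'n set" k] by simp

lemma lists_of_length_nonempty: "{js :: 'a list. length js = k} \<noteq> {}"
  using length_replicate[of k undefined] by blast

text \<open>Monotonicity and compatibility with adding constants in one inequality. Uniqueness takes
  for \<open>c\<close> the largest coordinate difference; the lower bound on \<open>F\<close> takes
  \<open>c = 0\<close> and a constant vector.\<close>

lemma sum_list_le_of_nth_le:
  fixes x y :: "real ^ 'n::finite"
  assumes "\<And>j. x $ j \<le> y $ j + c"
  shows "(\<Sum>j\<leftarrow>js. x $ j) \<le> (\<Sum>j\<leftarrow>js. y $ j) + real (length js) * c"
proof (induction js)
  case (Cons j js)
  with assms[of j] show ?case
    by (simp add: algebra_simps)
qed simp

text \<open>An inequality suffices for uniqueness, since exchanging the two eigenpairs gives the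
  reverse one.\<close>

lemma tropical_H_eigenvalue_le:
  fixes A :: "'n::finite list \<Rightarrow> real"
  assumes x: "tropical_H_eigenpair m A x lam" and y: "tropical_H_eigenpair m A y mu"
  shows "lam \<le> mu"
proof -
  let ?J = "{js :: 'n list. length js = m - 1}"
  \<comment> \<open>The least constant with \<open>x\<close> below \<open>y + ?c\<close>
    coordinatewise; equality holds at the index \<open>i\<close> obtained next, and only row
    \<open>i\<close> is compared.\<close>
  let ?c = "Max (range (\<lambda>j. x $ j - y $ j))"
  have "?c \<in> range (\<lambda>j. x $ j - y $ j)"
    by (intro Max_in) auto
  then obtain i where i: "?c = x $ i - y $ i"
    by (rule rangeE)
  have le: "x $ j \<le> y $ j + ?c" for j
  proof -
    have "x $ j - y $ j \<le> ?c"
      by (intro Max_ge) auto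
    then show ?thesis by linarith
  qed
  let ?g = "\<lambda>js. A (i # js) + (\<Sum>j\<leftarrow>js. y $ j)"
  have "Min (?g ` ?J) \<in> ?g ` ?J"
    using finite_lists_of_length lists_of_length_nonempty by (intro Min_in) auto
  \<comment> \<open>A minimiser for \<open>y\<close> in row \<open>i\<close>; for \<open>x\<close>
    it is merely a competitor.\<close>
  then obtain js where js: "length js = m - 1" "Min (?g ` ?J) = ?g js"
    by auto
  have "lam + real (m - 1) * x $ i = Min ((\<lambda>js. A (i # js) + (\<Sum>j\<leftarrow>js. x $ j)) ` ?J)"
    using x by (simp add: tropical_H_eigenpair_def)
  also have "\<dots> \<le> A (i # js) + (\<Sum>j\<leftarrow>js. x $ j)"
    using js finite_lists_of_length by (intro Min_le) auto
  \<comment> \<open>The \<open>m - 1\<close> summands cost \<open>(m - 1) * ?c\<close>, which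
    cancels against \<open>(m - 1) * (x $ i - y $ i)\<close> at the end.\<close>
  also have "\<dots> \<le> ?g js + real (m - 1) * ?c"
    using sum_list_le_of_nth_le[of x y ?c js, OF le] js by simp
  also have "?g js = mu + real (m - 1) * y $ i"
    using js y by (simp add: tropical_H_eigenpair_def)
  finally show ?thesis
    unfolding i by (simp add: algebra_simps)
qed

lemma tropical_H_eigenpair_exists:
  fixes A :: "'n::finite list \<Rightarrow> real"
  assumes "m \<ge> 2"
  shows "\<exists>x lam. tropical_H_eigenpair m A x lam"
proof -
  let ?J = "{js :: 'n list. length js = m - 1}"
  define k where "k = real (m - 1)"
  have k: "k > 0"
    using assms by (simp add: k_def)
  define F where "F = (\<lambda>(x :: real ^ 'n) i. Min ((\<lambda>js. A (i # js) + (\<Sum>j\<leftarrow>js. x $ j)) ` ?J))"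
  define lo where "lo = Min (A ` {js. length js = m})"
  define hi where "hi = Max (A ` {js. length js = m})"
  define \<mu> where "\<mu> = (\<lambda>x. Min (range (F x)))"
  define G where "G = (\<lambda>x. \<chi> i. (F x i - \<mu> x) / k)"
  \<comment> \<open>The side length is the gap between the bounds \<open>hi + k * x $ p\<close> and
    \<open>lo + k * x $ p\<close> on \<open>F x i\<close> proved below, divided by \<open>k\<close>;
    the term in \<open>x $ p\<close> cancels, so one box serves all \<open>x\<close>.\<close>
  define B where "B = cbox (0 :: real ^ 'n) (\<chi> i. (hi - lo) / k)"
  have len: "length (i # js) = m" if "length js = m - 1" for i :: 'n and js
    using that assms by simp
  have lo: "lo \<le> A (i # js)" and hi: "A (i # js) \<le> hi" if "length js = m - 1" for i js
    using len[OF that, of i] finite_lists_of_length[of m]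
    by (auto simp: lo_def hi_def intro!: Min_le Max_ge)
  have contF: "continuous_on S (\<lambda>x. F x i)" for S i
    unfolding F_def
    by (intro continuous_on_Min_image finite_lists_of_length lists_of_length_nonempty
        continuous_on_add continuous_on_const continuous_on_sum_list_nth)
  have "continuous_on B G"
    unfolding G_def \<mu>_def using k
    by (intro continuous_on_vec_lambda continuous_on_divide continuous_on_diff contF
        continuous_on_const continuous_on_Min_image) auto
  moreover have "G \<in> B \<rightarrow> B"
  proof
    fix x :: "real ^ 'n"
    obtain p where p: "\<And>j. x $ p \<le> x $ j"
      using arg_min_if_finite(1,2)[of UNIV "($) x"]
      by (metis UNIV_I UNIV_not_empty finite not_le)
    have upper: "F x i \<le> hi + k * x $ p" for i
    proof -
      have "F x i \<le> A (i # replicate (m - 1) p) + (\<Sum>j\<leftarrow>replicate (m - 1) p. x $ j)"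
        unfolding F_def by (intro Min_le finite_imageI imageI finite_lists_of_length) simp
      also have "\<dots> \<le> hi + k * x $ p"
        using hi[of "replicate (m - 1) p" i] by (simp add: k_def sum_list_replicate)
      finally show ?thesis .
    qed
    have lower: "lo + k * x $ p \<le> F x i" for i
    proof -
      have "lo + k * x $ p \<le> A (i # js) + (\<Sum>j\<leftarrow>js. x $ j)" if "length js = m - 1" for js
        using lo[OF that, of i] sum_list_le_of_nth_le[of "\<chi> j. x $ p" x 0 js] p that
        by (simp add: k_def sum_list_triv)
      then show ?thesis
        unfolding F_def using finite_lists_of_length lists_of_length_nonempty
        by (intro Min.boundedI) auto
    qed
    have "\<mu> x \<le> F x i" for i
      unfolding \<mu>_def by (intro Min_le) auto
    moreover have "lo + k * x $ p \<le> \<mu> x"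
      unfolding \<mu>_def using lower by (intro Min.boundedI) auto
    ultimately have "0 \<le> G x $ i \<and> G x $ i \<le> (hi - lo) / k" for i
      using k upper[of i] by (force simp: G_def intro!: divide_right_mono)
    then show "G x \<in> B"
      by (simp add: B_def mem_box_cart)
  qed
  \<comment> \<open>This makes the box nonempty, as Brouwer's theorem requires.\<close>
  moreover have "lo \<le> hi"
    using lo hi length_replicate order_trans by metis
  then have "0 \<in> B"
    using k by (simp add: B_def mem_box_cart)
  ultimately obtain x where "G x = x"
    using brouwer[of B G] by (metis B_def compact_cbox convex_box(1) empty_iff)
  then have "x $ i = (F x i - \<mu> x) / k" for i
    by (metis G_def vec_lambda_beta)
  \<comment> \<open>The normalising constant \<open>\<mu> x\<close> turns out to be the
    eigenvalue.\<close>
  then have "F x i = \<mu> x + k * x $ i" for i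
    using k by (simp add: field_simps)
  then show ?thesis
    unfolding tropical_H_eigenpair_def F_def k_def by blast
qed

theorem theorem1:
  fixes A :: "'n::finite list \<Rightarrow> real" and m :: nat
  assumes "m \<ge> 2"
  shows "\<exists>!lam. tropical_H_eigenvalue m A lam"
  using tropical_H_eigenpair_exists[OF assms, of A]
  unfolding tropical_H_eigenvalue_def
  by (meson tropical_H_eigenvalue_le order_antisym)

end
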